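(* For any matrix $B \in \mathbb{R}^{n\times n}$, $$\mathrm{inc}(B) \leq \xi(B) \leq 2\,\mathrm{inc}(B).$$
   Context: $\|\cdot\|$ denotes the spectral norm (largest singular value), $\|\cdot\|_\infty$ the largest absolute value of an entry of a matrix, and $\|\cdot\|_2$ the Euclidean norm of a vector. For a matrix $M \in \mathbb{R}^{n\times n}$ of rank $k$ with (compact) singular value decomposition $M = U\Sigma V^T$, $U,V \in \mathbb{R}^{n\times k}$, define the subspace $$T(M) = \{U X^T + Y V^T : X, Y \in \mathbb{R}^{n \times k}\}$$ and $$\xi(M) = \max_{N \in T(M),\ \|N\| \leq 1} \|N\|_\infty.$$ For a subspace $S \subseteq \mathbb{R}^n$, let $P_S$ be the orthogonal projection onto $S$ and $\beta(S) = \max_i \|P_S e_i\|_2$, where $e_i$ is the $i$-th standard basis vector. For $B \in \mathbb{R}^{n\times n}$, $$\mathrm{inc}(B) = \max\{\beta(\text{row-space}(B)),\ \beta(\text{column-space}(B))\}.$$ *)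

theory Defs
  imports "HOL-Analysis.Analysis"
begin

section \<open>Norms\<close>

definition singular_values :: "real^'n^'n \<Rightarrow> real set" where
  "singular_values M = {s. s \<ge> 0 \<and> (\<exists>x. x \<noteq> 0 \<and> (transpose M ** M) *v x = s\<^sup>2 *\<^sub>R x)}"

text \<open>The supremum is attained; see \<open>spectral_norm_attained\<close> and \<open>spectral_norm_eq_onorm\<close> below.\<close>

definition spectral_norm :: "real^'n^'n \<Rightarrow> real" where
  "spectral_norm M = Sup (singular_values M)"

definition max_entry_norm :: "real^'n^'n \<Rightarrow> real" where
  "max_entry_norm M = Max (range (\<lambda>(i, j). \<bar>M $ i $ j\<bar>))"


section \<open>Compact singular value decomposition and the subspace $T(M)$\<close>

text \<open>
  An $n \times k$ matrix, with \<open>k\<close> depending on the matrix at hand, is represented by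
  its sequence of columns \<open>U :: nat \<Rightarrow> real^'n\<close>, of which only those with index below \<open>k\<close> matter.
  The following is the $n \times n$ matrix $U X^T$ for two $n \times k$ matrices.
\<close>

definition mult_transpose :: "nat \<Rightarrow> (nat \<Rightarrow> real^'n) \<Rightarrow> (nat \<Rightarrow> real^'n) \<Rightarrow> real^'n^'n" where
  "mult_transpose k U X = (\<chi> i j. \<Sum>l<k. U l $ i * X l $ j)"

definition orthonormal_columns :: "nat \<Rightarrow> (nat \<Rightarrow> real^'n) \<Rightarrow> bool" where
  "orthonormal_columns k U \<longleftrightarrow> (\<forall>i<k. \<forall>j<k. U i \<bullet> U j = (if i = j then 1 else 0))"

text \<open>
  \<open>s\<close> is the diagonal of $\Sigma$, so that \<open>\<lambda>l. s l *\<^sub>R U l\<close> gives the columns of $U \Sigma$.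
  No order is imposed on the singular values, which is irrelevant for $T(M)$.
\<close>

definition compact_svd ::
  "real^'n^'n \<Rightarrow> (nat \<Rightarrow> real^'n) \<Rightarrow> (nat \<Rightarrow> real) \<Rightarrow> (nat \<Rightarrow> real^'n) \<Rightarrow> bool" where
  "compact_svd M U s V \<longleftrightarrow>
     orthonormal_columns (rank M) U \<and> orthonormal_columns (rank M) V \<and>
     (\<forall>l < rank M. s l > 0) \<and>
     M = mult_transpose (rank M) (\<lambda>l. s l *\<^sub>R U l) V"

text \<open>
  A compact singular value decomposition exists (\<open>compact_svd_exists\<close>), and the set below
  can be computed from any of them (\<open>tangent_space_eq\<close>).
\<close>

definition tangent_space :: "real^'n^'n \<Rightarrow> (real^'n^'n) set" where
  "tangent_space M =
     {mult_transpose (rank M) U X + mult_transpose (rank M) Y V | U s V X Y. compact_svd M U s V}"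

text \<open>The supremum is attained; see \<open>xi_attained\<close> below.\<close>

definition xi :: "real^'n^'n \<Rightarrow> real" where
  "xi M = Sup {max_entry_norm N | N. N \<in> tangent_space M \<and> spectral_norm N \<le> 1}"


section \<open>Incoherence\<close>

definition orth_proj :: "(real^'n) set \<Rightarrow> real^'n \<Rightarrow> real^'n" where
  "orth_proj S x = (THE y. y \<in> S \<and> (\<forall>z\<in>S. orthogonal (x - y) z))"

definition beta :: "(real^'n) set \<Rightarrow> real" where
  "beta S = Max (range (\<lambda>i. norm (orth_proj S (axis i 1))))"

definition row_space :: "real^'n^'n \<Rightarrow> (real^'n) set" where
  "row_space B = span (rows B)"

definition column_space :: "real^'n^'n \<Rightarrow> (real^'n) set" where
  "column_space B = span (columns B)"

definition inc :: "real^'n^'n \<Rightarrow> real" where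
  "inc B = max (beta (row_space B)) (beta (column_space B))"


section \<open>Well-definedness\<close>

lemma orth_proj_ex1:
  fixes S :: "(real^'n) set"
  assumes "subspace S"
  shows "\<exists>!y. y \<in> S \<and> (\<forall>z\<in>S. orthogonal (x - y) z)"
proof -
  obtain y z where yz: "y \<in> span S" "\<And>w. w \<in> span S \<Longrightarrow> orthogonal z w" "x = y + z"
    using orthogonal_subspace_decomp_exists[of S x] by blast
  have sp: "span S = S" using assms by (simp add: span_eq_iff)
  show ?thesis
  proof (rule ex1I[of _ y])
    show "y \<in> S \<and> (\<forall>z\<in>S. orthogonal (x - y) z)" using yz sp by auto
  next
    fix y' assume y': "y' \<in> S \<and> (\<forall>z\<in>S. orthogonal (x - y') z)"
    have d: "y' - y \<in> S" using y' yz(1) sp assms by (simp add: subspace_diff)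
    have "(x - y') \<bullet> (y' - y) = 0" "(x - y) \<bullet> (y' - y) = 0"
      using d y' yz sp by (auto simp: orthogonal_def)
    hence "(y' - y) \<bullet> (y' - y) = 0" by (simp add: inner_diff_left)
    thus "y' = y" by simp
  qed
qed

lemma adjoint_inner: "(A *v x) \<bullet> y = x \<bullet> (transpose A *v y)" for A :: "real^'n^'n"
  by (metis dot_lmul_matrix inner_commute transpose_matrix_vector transpose_transpose)

lemma onorm_singular:
  fixes M :: "real^'n^'n"
  obtains v where "norm v = 1" "norm (M *v v) = onorm ((*v) M)"
    "(transpose M ** M) *v v = (onorm ((*v) M))\<^sup>2 *\<^sub>R v"
proof -
  let ?s = "onorm ((*v) M)"
  have "\<exists>v\<in>sphere (0::real^'n) 1. \<forall>x\<in>sphere 0 1. norm (M *v x) \<le> norm (M *v v)"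
  proof (rule continuous_attains_sup)
    have "axis undefined 1 \<in> sphere (0::real^'n) 1" by simp
    thus "sphere (0::real^'n) 1 \<noteq> {}" by blast
    show "continuous_on (sphere 0 1) (\<lambda>x. norm (M *v x))"
      by (intro continuous_intros linear_continuous_on matrix_vector_mul_bounded_linear)
  qed simp
  then obtain v where v: "norm v = 1" and mx: "\<And>x. norm x = 1 \<Longrightarrow> norm (M *v x) \<le> norm (M *v v)"
    by auto
  have le: "norm (M *v x) \<le> norm (M *v v) * norm x" for x
  proof (cases "x = 0")
    case False
    have "norm (M *v (inverse (norm x) *\<^sub>R x)) \<le> norm (M *v v)"
      by (rule mx) (use False in simp)
    thus ?thesis using False
      by (simp add: matrix_vector_mult_scaleR field_simps)
  qed simp
  have s: "?s = norm (M *v v)"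
  proof (rule antisym)
    show "?s \<le> norm (M *v v)" by (rule onorm_le) (rule le)
    show "norm (M *v v) \<le> ?s"
      using onorm[OF matrix_vector_mul_bounded_linear[of M], of v] v by simp
  qed
  define q where "q x = ?s\<^sup>2 * (x \<bullet> x) - (M *v x) \<bullet> (M *v x)" for x
  have q0: "q x \<ge> 0" for x
    using power_mono[OF le[of x], of 2]
    unfolding q_def s by (simp add: power_mult_distrib power2_norm_eq_inner)
  have qv: "q v = 0"
    using v unfolding q_def s by (simp add: power2_norm_eq_inner norm_eq_1)
  define w where "w = ?s\<^sup>2 *\<^sub>R v - (transpose M ** M) *v v"
  have ww: "w \<bullet> w = ?s\<^sup>2 * (v \<bullet> w) - (M *v v) \<bullet> (M *v w)"
  proof -
    have "w \<bullet> w = ?s\<^sup>2 * (v \<bullet> w) - ((transpose M ** M) *v v) \<bullet> w"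
      unfolding w_def by (simp add: inner_diff_left)
    also have "((transpose M ** M) *v v) \<bullet> w = (M *v v) \<bullet> (M *v w)"
      using adjoint_inner[of "transpose M" "M *v v" w] by (simp add: matrix_vector_mul_assoc)
    finally show ?thesis .
  qed
  have quad: "q (v - t *\<^sub>R w) = t\<^sup>2 * q w - 2 * t * (w \<bullet> w)" for t
  proof -
    have "q (v - t *\<^sub>R w) = q v + t\<^sup>2 * q w - 2 * t * (?s\<^sup>2 * (v \<bullet> w) - (M *v v) \<bullet> (M *v w))"
      unfolding q_def
      by (simp add: matrix_vector_mult_diff_distrib matrix_vector_mult_scaleR inner_diff_left
          inner_diff_right inner_commute algebra_simps power2_eq_square)
    thus ?thesis using qv ww by simp
  qed
  have "w \<bullet> w = 0"
  proof (rule ccontr)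
    assume ne: "w \<bullet> w \<noteq> 0"
    hence pos: "w \<bullet> w > 0" using inner_ge_zero[of w] by linarith
    show False
    proof (cases "q w = 0")
      case True
      thus False using q0[of "v - 1 *\<^sub>R w"] quad[of 1] pos by simp
    next
      case False
      hence qp: "q w > 0" using q0[of w] by simp
      have "q (v - (w \<bullet> w / q w) *\<^sub>R w) = - (w \<bullet> w)\<^sup>2 / q w"
        unfolding quad using qp by (simp add: field_simps power2_eq_square)
      also have "\<dots> < 0" using pos qp by simp
      finally show False using q0[of "v - (w \<bullet> w / q w) *\<^sub>R w"] by simp
    qed
  qed
  hence "(transpose M ** M) *v v = ?s\<^sup>2 *\<^sub>R v" unfolding w_def by simp
  thus ?thesis using that v s by simp
qed

lemma singular_value_le_onorm:
  fixes M :: "real^'n^'n"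
  assumes "s \<in> singular_values M"
  shows "s \<le> onorm ((*v) M)"
proof -
  obtain x where s: "s \<ge> 0" and x: "x \<noteq> 0" "(transpose M ** M) *v x = s\<^sup>2 *\<^sub>R x"
    using assms by (auto simp: singular_values_def)
  have "(M *v x) \<bullet> (M *v x) = x \<bullet> ((transpose M ** M) *v x)"
    by (simp add: adjoint_inner matrix_vector_mul_assoc)
  also have "\<dots> = s\<^sup>2 * (x \<bullet> x)" by (simp add: x(2))
  finally have "(norm (M *v x))\<^sup>2 = (s * norm x)\<^sup>2"
    by (simp add: power2_norm_eq_inner power_mult_distrib)
  hence "norm (M *v x) = s * norm x" using s by (simp add: power2_eq_iff_nonneg)
  moreover have "norm (M *v x) \<le> onorm ((*v) M) * norm x"
    by (rule onorm) (rule matrix_vector_mul_bounded_linear)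
  ultimately show ?thesis using x(1) by simp
qed

lemma onorm_in_singular_values: "onorm ((*v) M) \<in> singular_values M" for M :: "real^'n^'n"
proof -
  obtain v where v: "norm v = 1" "(transpose M ** M) *v v = (onorm ((*v) M))\<^sup>2 *\<^sub>R v"
    using onorm_singular by blast
  have "v \<noteq> 0" using v(1) by auto
  thus ?thesis
    using v(2) onorm_pos_le[OF matrix_vector_mul_bounded_linear[of M]]
    unfolding singular_values_def by blast
qed

theorem spectral_norm_eq_onorm: "spectral_norm M = onorm ((*v) M)" for M :: "real^'n^'n"
  unfolding spectral_norm_def
  by (rule cSup_eq_maximum) (auto intro: onorm_in_singular_values singular_value_le_onorm)

theorem spectral_norm_attained: "spectral_norm M \<in> singular_values M" for M :: "real^'n^'n"
  by (simp add: spectral_norm_eq_onorm onorm_in_singular_values)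

lemma mult_transpose_vector: "mult_transpose k U X *v x = (\<Sum>l<k. (X l \<bullet> x) *\<^sub>R U l)"
proof -
  have "(\<Sum>j\<in>UNIV. (\<Sum>l<k. U l $ i * X l $ j) * x $ j) =
      (\<Sum>l<k. (\<Sum>j\<in>UNIV. X l $ j * x $ j) * U l $ i)" for i
    unfolding sum_distrib_right by (subst sum.swap) (simp add: mult_ac)
  thus ?thesis
    by (simp add: vec_eq_iff mult_transpose_def matrix_vector_mult_def inner_vec_def)
qed

lemma transpose_mult_transpose: "transpose (mult_transpose k U X) = mult_transpose k X U"
  by (simp add: vec_eq_iff mult_transpose_def transpose_def mult.commute)

lemma mult_transpose_scale:
  "mult_transpose k (\<lambda>l. s l *\<^sub>R U l) X = mult_transpose k U (\<lambda>l. s l *\<^sub>R X l)"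
  by (simp add: mult_transpose_def mult_ac)

lemma svd_image:
  assumes "orthonormal_columns k V" "l < k"
  shows "mult_transpose k (\<lambda>l. s l *\<^sub>R U l) V *v V l = s l *\<^sub>R U l"
proof -
  have "mult_transpose k (\<lambda>l. s l *\<^sub>R U l) V *v V l =
      (\<Sum>m<k. if m = l then s m *\<^sub>R U m else 0)"
    unfolding mult_transpose_vector
    by (rule sum.cong) (use assms in \<open>auto simp: orthonormal_columns_def\<close>)
  thus ?thesis using assms(2) by simp
qed

lemma svd_rank:
  fixes M :: "real^'n^'n"
  assumes U: "orthonormal_columns k U" and V: "orthonormal_columns k V"
    and s: "\<forall>l<k. s l > 0" and M: "M = mult_transpose k (\<lambda>l. s l *\<^sub>R U l) V"
  shows "rank M = k"
proof -
  have inj: "inj_on U {..<k}"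
  proof (rule inj_onI, rule ccontr)
    fix x y assume xy: "x \<in> {..<k}" "y \<in> {..<k}" "U x = U y" "x \<noteq> y"
    have "U x \<bullet> U y = 0" "U x \<bullet> U x = 1"
      using U xy(1,2,4) unfolding orthonormal_columns_def by (metis lessThan_iff)+
    thus False using xy(3) by simp
  qed
  have ind: "independent (U ` {..<k})"
  proof (rule pairwise_orthogonal_independent)
    show "pairwise orthogonal (U ` {..<k})"
      using U by (auto simp: pairwise_def orthogonal_def orthonormal_columns_def)
    show "0 \<notin> U ` {..<k}"
    proof
      assume "0 \<in> U ` {..<k}"
      then obtain l where "l < k" "U l = 0" by auto
      thus False using U[unfolded orthonormal_columns_def, rule_format, of l l] by simp
    qed
  qed
  have "range ((*v) M) = span (U ` {..<k})"
  proof
    show "range ((*v) M) \<subseteq> span (U ` {..<k})"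
      unfolding M mult_transpose_vector
      by (auto intro!: span_sum span_mul intro: span_base)
    have sub: "subspace (range ((*v) M))"
      by (intro linear_subspace_image) (auto simp: matrix_vector_mul_linear)
    have "U l \<in> range ((*v) M)" if "l < k" for l
    proof -
      have "M *v (inverse (s l) *\<^sub>R V l) = inverse (s l) *\<^sub>R s l *\<^sub>R U l"
        using svd_image[OF V that, of s U] M by (simp only: matrix_vector_mult_scaleR)
      also have "\<dots> = U l" using s that by auto
      finally show ?thesis by (metis rangeI)
    qed
    thus "span (U ` {..<k}) \<subseteq> range ((*v) M)"
      by (intro span_minimal sub) auto
  qed
  hence "rank M = dim (span (U ` {..<k}))" by (simp add: rank_dim_range)
  also have "\<dots> = k" using dim_eq_card_independent[OF ind] card_image[OF inj] by simp
  finally show ?thesis .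
qed

lemma svd_exists_aux:
  fixes M :: "real^'n^'n"
  shows "\<exists>k U s V. orthonormal_columns k U \<and> orthonormal_columns k V \<and>
    (\<forall>l<k. s l > 0) \<and> M = mult_transpose k (\<lambda>l. s l *\<^sub>R U l) V"
proof (induction "rank M" arbitrary: M rule: less_induct)
  case less
  show ?case
  proof (cases "M = 0")
    case True
    thus ?thesis
      by (intro exI[of _ 0]) (simp add: orthonormal_columns_def mult_transpose_def vec_eq_iff)
  next
    case False
    define t where "t = onorm ((*v) M)"
    obtain v where v: "norm v = 1" "norm (M *v v) = t" "(transpose M ** M) *v v = t\<^sup>2 *\<^sub>R v"
      using onorm_singular unfolding t_def by blast
    have "t \<noteq> 0"
    proof
      assume "t = 0"
      hence "\<forall>x. M *v x = 0"
        unfolding t_def by (simp add: onorm_eq_0[OF matrix_vector_mul_bounded_linear])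
      thus False using False by (metis matrix_eq matrix_vector_mult_0)
    qed
    hence t: "t > 0" using v(2) by (metis norm_ge_zero order_le_less)
    define u where "u = inverse t *\<^sub>R (M *v v)"
    have uu: "norm u = 1" using t v(2) by (simp add: u_def)
    have Mv: "M *v v = t *\<^sub>R u" using t by (simp add: u_def)
    have Mu: "transpose M *v u = t *\<^sub>R v"
    proof -
      have "transpose M *v u = inverse t *\<^sub>R t\<^sup>2 *\<^sub>R v"
        using v(3) by (simp only: u_def matrix_vector_mult_scaleR matrix_vector_mul_assoc)
      thus ?thesis using t by (simp add: power2_eq_square)
    qed
    define M' where "M' = M - mult_transpose 1 (\<lambda>_. t *\<^sub>R u) (\<lambda>_. v)"
    have M': "M' *v x = M *v x - (t * (v \<bullet> x)) *\<^sub>R u" for x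
      unfolding M'_def by (simp add: matrix_vector_mult_diff_rdistrib mult_transpose_vector mult.commute)
    have M'v: "M' *v v = 0" using v(1) by (simp add: M' Mv norm_eq_1)
    have M'u: "(M' *v x) \<bullet> u = 0" for x
    proof -
      have "(M *v x) \<bullet> u = x \<bullet> (t *\<^sub>R v)" by (simp only: adjoint_inner Mu)
      moreover have "u \<bullet> u = 1" using uu by (simp add: norm_eq_1)
      ultimately show ?thesis by (simp add: M' inner_diff_left inner_commute[of x v])
    qed
    have u_in: "u \<in> range ((*v) M)"
    proof -
      have "u = M *v (inverse t *\<^sub>R v)" by (simp only: u_def matrix_vector_mult_scaleR)
      thus ?thesis by blast
    qed
    have sub: "subspace (range ((*v) A))" for A :: "real^'n^'n"
      by (intro linear_subspace_image) (auto simp: matrix_vector_mul_linear)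
    have "range ((*v) M') \<subset> range ((*v) M)"
    proof
      show "range ((*v) M') \<subseteq> range ((*v) M)"
        using sub[of M] u_in by (auto simp: M' intro!: subspace_diff subspace_mul)
      have "u \<notin> range ((*v) M')"
      proof
        assume "u \<in> range ((*v) M')"
        then obtain x where "u = M' *v x" by auto
        hence "u \<bullet> u = 0" using M'u[of x] by simp
        thus False using uu by simp
      qed
      thus "range ((*v) M') \<noteq> range ((*v) M)" using u_in by blast
    qed
    hence "dim (range ((*v) M')) < dim (range ((*v) M))"
      using sub[of M] sub[of M'] by (intro dim_psubset) (metis span_eq_iff)
    hence "rank M' < rank M" by (simp add: rank_dim_range)
    from less[OF this] obtain k U s V where
      U: "orthonormal_columns k U" and V: "orthonormal_columns k V"
      and s: "\<forall>l<k. s l > 0" and M'eq: "M' = mult_transpose k (\<lambda>l. s l *\<^sub>R U l) V" by blast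
    have Uu: "U l \<bullet> u = 0" if "l < k" for l
    proof -
      have "(M' *v V l) \<bullet> u = 0" by (rule M'u)
      hence "s l * (U l \<bullet> u) = 0" unfolding M'eq svd_image[OF V that] by simp
      thus ?thesis using s that by force
    qed
    have Vv: "V l \<bullet> v = 0" if "l < k" for l
    proof -
      have "transpose M' *v U l = s l *\<^sub>R V l"
        unfolding M'eq transpose_mult_transpose mult_transpose_scale[symmetric]
        by (rule svd_image[OF U that])
      moreover have "(transpose M' *v U l) \<bullet> v = 0"
        by (simp only: adjoint_inner transpose_transpose M'v inner_zero_right)
      ultimately have "s l * (V l \<bullet> v) = 0" by simp
      thus ?thesis using s that by force
    qed
    have ext: "orthonormal_columns (Suc k) (W(k := w))"
      if "orthonormal_columns k W" "norm w = 1" "\<And>l. l < k \<Longrightarrow> W l \<bullet> w = 0" for W and w :: "real^'n"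
      using that unfolding orthonormal_columns_def
      by (auto simp: less_Suc_eq norm_eq_1 inner_commute)
    have "M = mult_transpose (Suc k) (\<lambda>l. (s(k := t)) l *\<^sub>R (U(k := u)) l) (V(k := v))"
    proof -
      have "M = M' + mult_transpose 1 (\<lambda>_. t *\<^sub>R u) (\<lambda>_. v)" by (simp add: M'_def)
      thus ?thesis unfolding M'eq by (simp add: vec_eq_iff mult_transpose_def)
    qed
    moreover have "\<forall>l<Suc k. (s(k := t)) l > 0" using s t by (auto simp: less_Suc_eq)
    ultimately show ?thesis using ext[OF U uu Uu] ext[OF V v(1) Vv] by blast
  qed
qed

theorem compact_svd_exists: "\<exists>U s V. compact_svd M U s V" for M :: "real^'n^'n"
  unfolding compact_svd_def using svd_exists_aux[of M] svd_rank by metis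

lemma mult_transpose_subset:
  assumes "\<And>l. l < k \<Longrightarrow> U l \<in> span (U' ` {..<k'})"
  shows "\<exists>X'. mult_transpose k U X = mult_transpose k' U' X'"
proof -
  have "\<exists>c. \<forall>l<k. U l = (\<Sum>m<k'. c l m *\<^sub>R U' m)"
  proof -
    have "\<exists>c. U l = (\<Sum>m<k'. c m *\<^sub>R U' m)" if "l < k" for l
    proof -
      have "\<exists>c. x = (\<Sum>m<k'. c m *\<^sub>R U' m)" if "x \<in> span (U' ` {..<k'})" for x
        using that
      proof (induction rule: span_induct_alt)
        case base
        show ?case by (intro exI[of _ "\<lambda>_. 0"]) simp
      next
        case (step a x y)
        then obtain m c where m: "m < k'" "x = U' m" "y = (\<Sum>m<k'. c m *\<^sub>R U' m)" by auto
        have "(\<Sum>j<k'. (c j + (if j = m then a else 0)) *\<^sub>R U' j) =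
            y + (\<Sum>j<k'. if j = m then a *\<^sub>R U' j else 0)"
          unfolding m(3) sum.distrib[symmetric] by (rule sum.cong) (auto simp: scaleR_left_distrib)
        hence "a *\<^sub>R x + y = (\<Sum>j<k'. (c j + (if j = m then a else 0)) *\<^sub>R U' j)"
          using m by simp
        thus ?case by (intro exI[of _ "\<lambda>j. c j + (if j = m then a else 0)"])
      qed
      thus ?thesis using assms[OF that] by blast
    qed
    thus ?thesis by metis
  qed
  then obtain c where c: "\<And>l. l < k \<Longrightarrow> U l = (\<Sum>m<k'. c l m *\<^sub>R U' m)" by blast
  have "(\<Sum>l<k. U l $ i * X l $ j) = (\<Sum>m<k'. U' m $ i * (\<Sum>l<k. c l m *\<^sub>R X l) $ j)" for i j
  proof -
    have "(\<Sum>l<k. U l $ i * X l $ j) = (\<Sum>l<k. \<Sum>m<k'. c l m * U' m $ i * X l $ j)"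
      by (rule sum.cong) (auto simp: c sum_distrib_right)
    also have "\<dots> = (\<Sum>m<k'. \<Sum>l<k. c l m * U' m $ i * X l $ j)" by (rule sum.swap)
    finally show ?thesis by (simp add: sum_distrib_left mult_ac)
  qed
  thus ?thesis
    by (intro exI[of _ "\<lambda>m. \<Sum>l<k. c l m *\<^sub>R X l"]) (simp add: mult_transpose_def)
qed

lemma compact_svd_left_in_span:
  assumes "compact_svd M U s V" "compact_svd M U' s' V'" "l < rank M"
  shows "U l \<in> span (U' ` {..<rank M})"
proof -
  have V: "orthonormal_columns (rank M) V" and "s l > 0"
    and M: "M = mult_transpose (rank M) (\<lambda>l. s l *\<^sub>R U l) V"
    and M': "M = mult_transpose (rank M) (\<lambda>l. s' l *\<^sub>R U' l) V'"
    using assms unfolding compact_svd_def by auto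
  have "s l *\<^sub>R U l = M *v V l"
    by (subst M) (simp add: svd_image[OF V assms(3)])
  also have "\<dots> \<in> span (U' ` {..<rank M})"
    by (subst M') (auto simp: mult_transpose_vector intro!: span_sum span_mul intro: span_base)
  finally have "inverse (s l) *\<^sub>R s l *\<^sub>R U l \<in> span (U' ` {..<rank M})" by (rule span_mul)
  thus ?thesis using \<open>s l > 0\<close> by simp
qed

lemma compact_svd_transpose:
  assumes "compact_svd M U s V"
  shows "compact_svd (transpose M) V s U"
proof -
  have "M = mult_transpose (rank M) (\<lambda>l. s l *\<^sub>R U l) V"
    using assms unfolding compact_svd_def by blast
  hence "transpose M = transpose (mult_transpose (rank M) (\<lambda>l. s l *\<^sub>R U l) V)"
    by (rule arg_cong)
  also have "\<dots> = mult_transpose (rank M) (\<lambda>l. s l *\<^sub>R V l) U"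
    by (simp only: transpose_mult_transpose mult_transpose_scale)
  finally show ?thesis
    using assms unfolding compact_svd_def rank_transpose by blast
qed

lemma compact_svd_independent:
  assumes "compact_svd M U s V" "compact_svd M U' s' V'"
  shows "\<exists>X' Y'. mult_transpose (rank M) U X + mult_transpose (rank M) Y V =
    mult_transpose (rank M) U' X' + mult_transpose (rank M) Y' V'"
proof -
  have "\<exists>X'. mult_transpose (rank M) U X = mult_transpose (rank M) U' X'"
    using compact_svd_left_in_span[OF assms] by (rule mult_transpose_subset)
  moreover have "\<exists>Y'. mult_transpose (rank M) V Y = mult_transpose (rank M) V' Y'"
    using compact_svd_left_in_span[OF compact_svd_transpose compact_svd_transpose, OF assms]
    by (intro mult_transpose_subset) (simp add: rank_transpose)
  ultimately show ?thesis by (metis transpose_mult_transpose)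
qed

theorem tangent_space_eq:
  assumes "compact_svd M U s V"
  shows "tangent_space M =
    {mult_transpose (rank M) U X + mult_transpose (rank M) Y V | X Y. True}"
  unfolding tangent_space_def using assms compact_svd_independent[OF _ assms] by blast

theorem subspace_tangent_space: "subspace (tangent_space M)" for M :: "real^'n^'n"
proof -
  obtain U s V where svd: "compact_svd M U s V" using compact_svd_exists by blast
  let ?A = "\<lambda>X Y. mult_transpose (rank M) U X + mult_transpose (rank M) Y V"
  have T: "tangent_space M = {?A X Y | X Y. True}" by (rule tangent_space_eq[OF svd])
  have add: "?A X Y + ?A X' Y' = ?A (\<lambda>l. X l + X' l) (\<lambda>l. Y l + Y' l)" for X Y X' Y'
    by (simp add: vec_eq_iff mult_transpose_def sum.distrib distrib_left distrib_right)
  have scale: "c *\<^sub>R ?A X Y = ?A (\<lambda>l. c *\<^sub>R X l) (\<lambda>l. c *\<^sub>R Y l)" for c X Y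
    by (simp add: vec_eq_iff mult_transpose_def sum_distrib_left distrib_left mult_ac)
  have zero: "0 = ?A (\<lambda>_. 0) (\<lambda>_. 0)" by (simp add: vec_eq_iff mult_transpose_def)
  show ?thesis
    unfolding subspace_def T using add scale zero by blast
qed

theorem xi_attained:
  fixes M :: "real^'n^'n"
  obtains N where "N \<in> tangent_space M" "spectral_norm N \<le> 1" "xi M = max_entry_norm N"
    "\<And>N'. N' \<in> tangent_space M \<Longrightarrow> spectral_norm N' \<le> 1 \<Longrightarrow> max_entry_norm N' \<le> max_entry_norm N"
proof -
  let ?K = "{N \<in> tangent_space M. spectral_norm N \<le> 1}"
  let ?L = "\<Inter>x. {N :: real^'n^'n. norm (N *v x) \<le> norm x}"
  have "spectral_norm N \<le> 1 \<longleftrightarrow> N \<in> ?L" for N :: "real^'n^'n"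
  proof
    assume a: "spectral_norm N \<le> 1"
    have "norm (N *v x) \<le> norm x" for x
      using onorm[OF matrix_vector_mul_bounded_linear[of N], of x] a
        mult_right_mono[of "spectral_norm N" 1 "norm x"]
      by (simp add: spectral_norm_eq_onorm)
    thus "N \<in> ?L" by simp
  next
    assume "N \<in> ?L"
    thus "spectral_norm N \<le> 1"
      unfolding spectral_norm_eq_onorm by (intro onorm_le) simp
  qed
  hence K: "?K = tangent_space M \<inter> ?L" by blast
  have lin: "linear (\<lambda>N :: real^'n^'n. N *v x)" for x
    by (rule linearI) (simp_all add: matrix_vector_mult_add_rdistrib scaleR_matrix_vector_assoc)
  have "closed ?L"
    by (intro closed_INT ballI closed_Collect_le continuous_intros linear_continuous_on
        linear_conv_bounded_linear[THEN iffD1] lin)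
  hence cl: "closed ?K"
    unfolding K by (rule closed_Int[OF closed_subspace[OF subspace_tangent_space]])
  have entry: "\<bar>N $ i $ j\<bar> \<le> 1" if "N \<in> ?L" for N i j
  proof -
    have "\<bar>N $ i $ j\<bar> = \<bar>(N *v axis j 1) $ i\<bar>"
      by (simp add: matrix_vector_mult_basis column_def)
    also have "\<dots> \<le> norm (N *v axis j 1)" by (rule component_le_norm_cart)
    also have "\<dots> \<le> norm (axis j 1 :: real^'n)" using that by blast
    finally show ?thesis by simp
  qed
  have "bounded ?K"
  proof (rule boundedI)
    fix N assume "N \<in> ?K"
    hence e: "\<bar>N $ i $ j\<bar> \<le> 1" for i j using K entry by blast
    have "norm N \<le> (\<Sum>i\<in>UNIV. norm (N $ i))"
      unfolding norm_vec_def by (rule L2_set_le_sum) simp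
    also have "\<dots> \<le> (\<Sum>i\<in>UNIV. \<Sum>j\<in>UNIV. \<bar>N $ i $ j\<bar>)"
      by (intro sum_mono norm_le_l1_cart)
    also have "\<dots> \<le> (\<Sum>i\<in>(UNIV::'n set). \<Sum>j\<in>(UNIV::'n set). 1)" by (intro sum_mono e)
    finally show "norm N \<le> (\<Sum>i\<in>(UNIV::'n set). \<Sum>j\<in>(UNIV::'n set). 1)" .
  qed
  hence comp: "compact ?K" using cl by (simp add: compact_eq_bounded_closed)
  have ne: "?K \<noteq> {}"
  proof -
    have "0 \<in> tangent_space M" using subspace_tangent_space by (rule subspace_0)
    moreover have "(0 :: real^'n^'n) \<in> ?L" by simp
    ultimately show ?thesis unfolding K by blast
  qed
  have Max: "max_entry_norm N = Max ((\<lambda>p. \<bar>N $ fst p $ snd p\<bar>) ` UNIV)" for N :: "real^'n^'n"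
    by (simp add: max_entry_norm_def case_prod_beta)
  have cont: "continuous_on ?K max_entry_norm"
  proof -
    have le: "max_entry_norm A \<le> max_entry_norm B + norm (A - B)" for A B :: "real^'n^'n"
    proof -
      have "\<bar>A $ fst p $ snd p\<bar> \<le> max_entry_norm B + norm (A - B)" for p
      proof -
        have "\<bar>B $ fst p $ snd p\<bar> \<le> max_entry_norm B" unfolding Max by simp
        moreover have "\<bar>(A - B) $ fst p $ snd p\<bar> \<le> norm (A - B)"
          using component_le_norm_cart[of "(A - B) $ fst p" "snd p"]
            Finite_Cartesian_Product.norm_nth_le[of "A - B" "fst p"] by linarith
        ultimately show ?thesis by simp
      qed
      thus ?thesis unfolding Max[of A] by simp
    qed
    show ?thesis
      unfolding continuous_on_iff dist_norm
    proof (intro ballI allI impI)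
      fix x e assume "e > (0::real)"
      have "norm (max_entry_norm y - max_entry_norm x) \<le> norm (y - x)" for y :: "real^'n^'n"
        using le[of x y] le[of y x] by (simp add: norm_minus_commute abs_le_iff)
      thus "\<exists>d>0. \<forall>y\<in>?K. norm (y - x) < d \<longrightarrow> norm (max_entry_norm y - max_entry_norm x) < e"
        using \<open>e > 0\<close> by (meson le_less_trans)
    qed
  qed
  obtain N where N: "N \<in> ?K" "\<And>N'. N' \<in> ?K \<Longrightarrow> max_entry_norm N' \<le> max_entry_norm N"
    using continuous_attains_sup[OF comp ne cont] by blast
  have "xi M = max_entry_norm N"
    unfolding xi_def using N by (intro cSup_eq_maximum) auto
  thus ?thesis using that[of N] N by blast
qed

end

theory Submission
  imports Defs
begin

text \<open>
  Write $C$ and $R$ for the column and row space. The tangent space contains every rank-one matrix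
  $a b^T$ with $a \in C$ or $b \in R$, and $a^T N b = 0$ for $N$ in it when $a \perp C$, $b \perp R$.
  Lower bound: for $p = P_C e_i \noteq 0$ the matrix $p e_i^T / \|p\|$ has norm $1$ and
  $(i,i)$ entry $\|p\|$, and symmetrically for $R$.
  Upper bound: with $p = P_C e_i$ and $q = P_R e_j$,
  $N_{ij} = p \cdot N e_j + (e_i - p) \cdot N q + (e_i - p) \cdot N (e_j - q)$,
  where the last term vanishes and the other two are at most $\|p\|$ and $\|q\|$.
\<close>

lemma
  fixes S :: "(real^'n) set"
  assumes "subspace S"
  shows orth_proj_in: "orth_proj S x \<in> S"
    and orth_proj_orthogonal: "z \<in> S \<Longrightarrow> (x - orth_proj S x) \<bullet> z = 0"
  using theI'[OF orth_proj_ex1[OF assms, of x]]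
  unfolding orth_proj_def orthogonal_def by blast+

text \<open>The residual \<open>x - orth_proj S x\<close> is orthogonal to the projection, which
  itself lies in \<open>S\<close>.\<close>

lemma inner_orth_proj:
  fixes S :: "(real^'n) set"
  assumes "subspace S"
  shows "orth_proj S x \<bullet> x = (norm (orth_proj S x))\<^sup>2"
  using orth_proj_orthogonal[OF assms orth_proj_in[OF assms], of x x]
  by (simp add: power2_norm_eq_inner inner_diff_left inner_commute[of x])

text \<open>Pythagoras: the squared norms of the projection and of the residual add up to that of
  \<open>x\<close>.\<close>

lemma norm_diff_orth_proj_le:
  fixes S :: "(real^'n) set"
  assumes "subspace S"
  shows "norm (x - orth_proj S x) \<le> norm x"
proof (rule power2_le_imp_le)
  let ?p = "orth_proj S x"
  have "(norm (x - ?p))\<^sup>2 = (norm x)\<^sup>2 - (norm ?p)\<^sup>2"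
    using inner_orth_proj[OF assms, of x]
    by (simp add: power2_norm_eq_inner inner_diff_left inner_diff_right inner_commute)
  thus "(norm (x - ?p))\<^sup>2 \<le> (norm x)\<^sup>2" by simp
qed simp

lemma norm_orth_proj_axis_le_beta: "norm (orth_proj S (axis i 1)) \<le> beta S"
  unfolding beta_def by (rule Max_ge) auto

lemma subspace_column_space: "subspace (column_space B)"
  by (simp add: column_space_def)

lemma subspace_row_space: "subspace (row_space B)"
  by (simp add: row_space_def)

lemma column_space_transpose: "column_space (transpose B) = row_space B"
  by (simp add: column_space_def row_space_def)

text \<open>Every \<open>B *v x\<close> is a combination of the left singular vectors. Conversely
  \<open>B *v V l = s l *\<^sub>R U l\<close>, and \<open>s l > 0\<close> allows division.\<close>

lemma column_space_svd:
  assumes "compact_svd B U s V"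
  shows "column_space B = span (U ` {..<rank B})"
proof
  have V: "orthonormal_columns (rank B) V" and s: "\<And>l. l < rank B \<Longrightarrow> s l > 0"
    and B: "B = mult_transpose (rank B) (\<lambda>l. s l *\<^sub>R U l) V"
    using assms unfolding compact_svd_def by auto
  have "B *v x \<in> span (U ` {..<rank B})" for x
    by (subst B) (auto simp: mult_transpose_vector intro!: span_sum span_mul intro: span_base)
  hence "columns B \<subseteq> span (U ` {..<rank B})"
    by (auto simp: columns_def simp flip: matrix_vector_mult_basis)
  thus "column_space B \<subseteq> span (U ` {..<rank B})"
    unfolding column_space_def by (intro span_minimal) auto
  have "U l \<in> column_space B" if l: "l < rank B" for l
  proof -
    have "s l *\<^sub>R U l = B *v V l"
      by (subst B) (simp add: svd_image[OF V l])
    also have "\<dots> \<in> column_space B"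
      unfolding column_space_def by (rule matrix_vector_mult_in_columnspace)
    finally have "inverse (s l) *\<^sub>R s l *\<^sub>R U l \<in> column_space B"
      by (rule subspace_mul[OF subspace_column_space])
    thus ?thesis using s[OF l] by simp
  qed
  thus "span (U ` {..<rank B}) \<subseteq> column_space B"
    by (intro span_minimal subspace_column_space) auto
qed

lemma row_space_svd:
  assumes "compact_svd B U s V"
  shows "row_space B = span (V ` {..<rank B})"
  using column_space_svd[OF compact_svd_transpose[OF assms]]
  by (simp add: column_space_transpose rank_transpose)

text \<open>\<open>N *v b\<close> is the sum of the \<open>(X l \<bullet> b) *\<^sub>R U l\<close>
  and the \<open>(V l \<bullet> b) *\<^sub>R Y l\<close>: \<open>a\<close> annihilates each
  \<open>U l\<close>, and \<open>V l \<bullet> b\<close> is zero.\<close>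

lemma tangent_space_orthogonal:
  assumes "N \<in> tangent_space B"
    and a: "\<And>z. z \<in> column_space B \<Longrightarrow> a \<bullet> z = 0"
    and b: "\<And>z. z \<in> row_space B \<Longrightarrow> b \<bullet> z = 0"
  shows "a \<bullet> (N *v b) = 0"
proof -
  obtain U s V where svd: "compact_svd B U s V" using compact_svd_exists by blast
  then obtain X Y where N: "N = mult_transpose (rank B) U X + mult_transpose (rank B) Y V"
    using assms(1) unfolding tangent_space_eq[OF svd] by blast
  have "a \<bullet> U l = 0" "V l \<bullet> b = 0" if "l < rank B" for l
    using a[of "U l"] b[of "V l"] that
    unfolding column_space_svd[OF svd] row_space_svd[OF svd]
    by (auto intro: span_base simp: inner_commute)
  thus ?thesis
    unfolding N by (simp add: matrix_vector_mult_add_rdistrib mult_transpose_vector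
        inner_add_right inner_sum_right)
qed

text \<open>A left factor in the span of the \<open>U l\<close> can be re-expanded over them, which
  makes the matrix a product \<open>mult_transpose (rank B) U X\<close>; the other summand is taken
  to be zero.\<close>

lemma rank_one_in_tangent_space:
  assumes "a \<in> column_space B \<or> b \<in> row_space B"
  shows "mult_transpose 1 (\<lambda>_. a) (\<lambda>_. b) \<in> tangent_space B"
proof -
  obtain U s V where svd: "compact_svd B U s V" using compact_svd_exists by blast
  have zero: "mult_transpose k (\<lambda>_. 0) W = 0" "mult_transpose k W (\<lambda>_. 0) = 0"
    for k and W :: "nat \<Rightarrow> real^'a"
    by (simp_all add: vec_eq_iff mult_transpose_def)
  from assms show ?thesis
  proof
    assume "a \<in> column_space B"
    then obtain X where "mult_transpose 1 (\<lambda>_. a) (\<lambda>_. b) = mult_transpose (rank B) U X"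
      using mult_transpose_subset[of 1 "\<lambda>_. a" U "rank B"]
      unfolding column_space_svd[OF svd] by blast
    hence "mult_transpose 1 (\<lambda>_. a) (\<lambda>_. b) =
        mult_transpose (rank B) U X + mult_transpose (rank B) (\<lambda>_. 0) V"
      by (simp add: zero)
    thus ?thesis unfolding tangent_space_eq[OF svd] by blast
  next
    assume "b \<in> row_space B"
    \<comment> \<open>\<open>mult_transpose_subset\<close> re-expands left factors only, so it is
      applied to the transposed matrix.\<close>
    then obtain Y where "mult_transpose 1 (\<lambda>_. b) (\<lambda>_. a) = mult_transpose (rank B) V Y"
      using mult_transpose_subset[of 1 "\<lambda>_. b" V "rank B"]
      unfolding row_space_svd[OF svd] by blast
    hence "mult_transpose 1 (\<lambda>_. a) (\<lambda>_. b) = mult_transpose (rank B) Y V"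
      by (metis transpose_mult_transpose)
    hence "mult_transpose 1 (\<lambda>_. a) (\<lambda>_. b) =
        mult_transpose (rank B) U (\<lambda>_. 0) + mult_transpose (rank B) Y V"
      by (simp add: zero)
    thus ?thesis unfolding tangent_space_eq[OF svd] by blast
  qed
qed

lemma norm_mult_vector_le:
  assumes "spectral_norm N \<le> 1"
  shows "norm (N *v x) \<le> norm x"
  using onorm[OF matrix_vector_mul_bounded_linear[of N], of x] assms
    mult_right_mono[of "spectral_norm N" 1 "norm x"]
  by (simp add: spectral_norm_eq_onorm)

text \<open>The matrix sends \<open>x\<close> to \<open>(b \<bullet> x) *\<^sub>R a\<close>, so
  Cauchy-Schwarz gives the bound.\<close>

lemma spectral_norm_rank_one_le:
  "spectral_norm (mult_transpose 1 (\<lambda>_. a) (\<lambda>_. b)) \<le> norm a * norm b"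
  unfolding spectral_norm_eq_onorm
proof (rule onorm_le)
  fix x
  have "\<bar>b \<bullet> x\<bar> * norm a \<le> norm b * norm x * norm a"
    by (intro mult_right_mono Cauchy_Schwarz_ineq2 norm_ge_zero)
  thus "norm (mult_transpose 1 (\<lambda>_. a) (\<lambda>_. b) *v x) \<le> norm a * norm b * norm x"
    by (simp add: mult_transpose_vector mult_ac)
qed

lemma abs_entry_le_max_entry_norm: "\<bar>N $ i $ j\<bar> \<le> max_entry_norm N"
  unfolding max_entry_norm_def by (rule Max_ge) auto

lemma abs_entry_le_xi:
  assumes "N \<in> tangent_space B" "spectral_norm N \<le> 1"
  shows "\<bar>N $ i $ j\<bar> \<le> xi B"
  using xi_attained[of B] abs_entry_le_max_entry_norm[of N i j] assms by (metis order_trans)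

text \<open>The rank-one matrix built from \<open>a\<close> and \<open>b\<close> is admissible in
  the supremum \<open>xi B\<close>. Only one factor has to lie in its space, so the other is free to
  be a basis vector.\<close>

lemma rank_one_entry_le_xi:
  assumes "a \<in> column_space B \<or> b \<in> row_space B" "norm a \<le> 1" "norm b \<le> 1"
  shows "a $ i * b $ j \<le> xi B"
proof -
  have "norm a * norm b \<le> 1" using assms(2,3) by (simp add: mult_le_one)
  hence "\<bar>mult_transpose 1 (\<lambda>_. a) (\<lambda>_. b) $ i $ j\<bar> \<le> xi B"
    by (intro abs_entry_le_xi rank_one_in_tangent_space assms(1)
        order_trans[OF spectral_norm_rank_one_le])
  thus ?thesis by (simp add: mult_transpose_def)
qed

text \<open>The witness is the normalized projection \<open>p\<close> of the basis vector: its
  coordinate \<open>p $ i\<close> is the inner product of \<open>p\<close> with that vector, hence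
  the squared norm of \<open>p\<close>.\<close>

lemma orth_proj_axis_unit:
  fixes S :: "(real^'n) set"
  assumes "subspace S"
  obtains u where "u \<in> S" "norm u \<le> 1" "u $ i = norm (orth_proj S (axis i 1))"
proof
  let ?p = "orth_proj S (axis i 1)"
  \<comment> \<open>As \<open>inverse 0 = 0\<close>, the witness is also correct when \<open>?p = 0\<close>.\<close>
  show "inverse (norm ?p) *\<^sub>R ?p \<in> S"
    by (intro subspace_mul orth_proj_in assms)
  show "norm (inverse (norm ?p) *\<^sub>R ?p) \<le> 1"
    by (cases "?p = 0") simp_all
  have "?p $ i = (norm ?p)\<^sup>2"
    using inner_orth_proj[OF assms, of "axis i 1"] by (simp add: inner_axis)
  thus "(inverse (norm ?p) *\<^sub>R ?p) $ i = norm ?p"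
    by (cases "?p = 0") (simp_all add: power2_eq_square)
qed

lemma inc_le_xi: "inc B \<le> xi B"
proof -
  have "norm (orth_proj (column_space B) (axis i 1)) \<le> xi B" for i
  proof -
    obtain u where "u \<in> column_space B" "norm u \<le> 1"
        "u $ i = norm (orth_proj (column_space B) (axis i 1))"
      using orth_proj_axis_unit[OF subspace_column_space] .
    thus ?thesis using rank_one_entry_le_xi[of u B "axis i 1" i i] by simp
  qed
  moreover have "norm (orth_proj (row_space B) (axis i 1)) \<le> xi B" for i
  proof -
    obtain v where "v \<in> row_space B" "norm v \<le> 1"
        "v $ i = norm (orth_proj (row_space B) (axis i 1))"
      using orth_proj_axis_unit[OF subspace_row_space] .
    thus ?thesis using rank_one_entry_le_xi[of "axis i 1" B v i i] by simp
  qed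
  ultimately show ?thesis unfolding inc_def beta_def by simp
qed

lemma abs_entry_le_2_inc:
  assumes N: "N \<in> tangent_space B" "spectral_norm N \<le> 1"
  shows "\<bar>N $ i $ j\<bar> \<le> 2 * inc B"
proof -
  let ?x = "axis i 1" and ?y = "axis j 1"
  define p where "p = orth_proj (column_space B) ?x"
  define q where "q = orth_proj (row_space B) ?y"
  have "N $ i $ j = ?x \<bullet> (N *v ?y)"
    by (simp add: inner_axis' matrix_vector_mult_basis column_def)
  also have "\<dots> = p \<bullet> (N *v ?y) + (?x - p) \<bullet> (N *v q) + (?x - p) \<bullet> (N *v (?y - q))"
    by (simp add: matrix_vector_mult_diff_distrib inner_diff_left inner_diff_right)
  also have "(?x - p) \<bullet> (N *v (?y - q)) = 0"
    unfolding p_def q_def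
    by (intro tangent_space_orthogonal[OF N(1)] orth_proj_orthogonal
        subspace_column_space subspace_row_space)
  finally have "\<bar>N $ i $ j\<bar> \<le> \<bar>p \<bullet> (N *v ?y)\<bar> + \<bar>(?x - p) \<bullet> (N *v q)\<bar>"
    by simp
  also have "\<dots> \<le> norm p * norm (N *v ?y) + norm (?x - p) * norm (N *v q)"
    by (intro add_mono Cauchy_Schwarz_ineq2)
  \<comment> \<open>\<open>N\<close> does not increase norms, and the residual of a unit vector has
    norm at most 1.\<close>
  also have "\<dots> \<le> norm p * 1 + 1 * norm q"
  proof (intro add_mono mult_mono)
    show "norm (N *v ?y) \<le> 1" using norm_mult_vector_le[OF N(2), of ?y] by simp
    show "norm (?x - p) \<le> 1"
      using norm_diff_orth_proj_le[OF subspace_column_space, of ?x B] by (simp add: p_def)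
    show "norm (N *v q) \<le> norm q" by (rule norm_mult_vector_le[OF N(2)])
  qed simp_all
  \<comment> \<open>The factor 2 arises here: \<open>norm p\<close> and \<open>norm q\<close> are
    bounded by the \<open>beta\<close> of the column space and of the row space, each at most
    \<open>inc B\<close>.\<close>
  also have "\<dots> \<le> 2 * inc B"
    using norm_orth_proj_axis_le_beta[of "column_space B" i]
      norm_orth_proj_axis_le_beta[of "row_space B" j]
    by (simp add: p_def q_def inc_def)
  finally show ?thesis .
qed

text \<open>As the supremum is attained, it suffices to bound the entries of one maximizer.\<close>

lemma xi_le_2_inc: "xi B \<le> 2 * inc B"
proof -
  obtain N where N: "N \<in> tangent_space B" "spectral_norm N \<le> 1" "xi B = max_entry_norm N"
    using xi_attained[of B] by blast
  show ?thesis
    unfolding N(3) max_entry_norm_def using abs_entry_le_2_inc[OF N(1,2)]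
    by (subst Max_le_iff) auto
qed

theorem proposition4:
  fixes B :: "real^'n^'n"
  shows "inc B \<le> xi B \<and> xi B \<le> 2 * inc B"
  using inc_le_xi xi_le_2_inc by blast

end
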